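(* Let $G=(V,E)$ be a digraph with energy $\mathcal{E}(G)$, Randić index $R(G)$ and maximum degree $\Delta(G)$. Then $\mathcal{E}(G)\leq 2\sqrt{\Delta(G)}\,R(G)$.
   Context: A digraph is a pair $G=(V,E)$ with $V=\{v_1,\dots,v_n\}$ a finite set and $E\subset V\times V$ such that $(v,v)\notin E$ for all $v\in V$ (both $(v,w)$ and $(w,v)$ may belong to $E$). Its adjacency matrix $A$ is the $n\times n$ matrix with $A_{ij}=1$ if $(v_i,v_j)\in E$ and $A_{ij}=0$ otherwise. The energy of $G$ is $\mathcal{E}(G)=\mathrm{Tr}((AA^t)^{1/2})=\mathrm{Tr}((A^tA)^{1/2})$, i.e. the sum of the singular values of $A$ counted with multiplicity. For $v\in V$, the outer degree is $d^+(v)=|\{w\in V:(v,w)\in E\}|$ and the inner degree is $d^-(v)=|\{w\in V:(w,v)\in E\}|$. $\Delta(G)$ is the maximum, over all vertices, of the inner and outer degrees. The Randić index of $G$ is $$R(G)=\frac{1}{2}\sum_{(v,w)\in E}\frac{1}{\sqrt{d^+(v)\,d^-(w)}}.$$ *)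

theory Defs
  imports
    Complex_Main
    "Graph_Theory.Pair_Digraph"
    "Jordan_Normal_Form.Matrix"
begin

(* The matrix depends on an enumeration vs of the vertices, fixed by the caller. *)
definition adjacency_mat :: "'a pair_pre_digraph \<Rightarrow> 'a list \<Rightarrow> real mat" where
  "adjacency_mat G vs =
     mat (length vs) (length vs) (\<lambda>(i, j). if (vs ! i, vs ! j) \<in> parcs G then 1 else 0)"

definition mat_trace :: "real mat \<Rightarrow> real" where
  "mat_trace M = (\<Sum>i<dim_row M. M $$ (i, i))"

definition psd_mat :: "real mat \<Rightarrow> bool" where
  "psd_mat M \<longleftrightarrow> square_mat M \<and> M\<^sup>T = M \<and>
     (\<forall>x \<in> carrier_vec (dim_row M). 0 \<le> x \<bullet> (M *\<^sub>v x))"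

(* The power 1/2 of a positive semidefinite matrix: its unique positive semidefinite
   square root. On other arguments the value is unspecified. *)
definition mat_sqrt :: "real mat \<Rightarrow> real mat" where
  "mat_sqrt M = (THE B. psd_mat B \<and> B * B = M)"

definition energy :: "'a pair_pre_digraph \<Rightarrow> 'a list \<Rightarrow> real" where
  "energy G vs = mat_trace (mat_sqrt (adjacency_mat G vs * (adjacency_mat G vs)\<^sup>T))"

(* For the digraph without vertices this is an unspecified natural number. *)
definition max_degree :: "'a pair_pre_digraph \<Rightarrow> nat" where
  "max_degree G =
     Max (in_degree (with_proj G) ` pverts G \<union> out_degree (with_proj G) ` pverts G)"

definition randic_index :: "'a pair_pre_digraph \<Rightarrow> real" where
  "randic_index G = 1 / 2 * (\<Sum>(v, w) \<in> parcs G.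
     1 / sqrt (real (out_degree (with_proj G) v) * real (in_degree (with_proj G) w)))"

end

theory Submission
  imports Defs "HOL-Analysis.Function_Topology"
begin

text \<open>If \<open>B\<close> is the positive semidefinite square root of \<open>A * A\<^sup>T\<close>, then the square of \<open>B\<^sub>i\<^sub>i\<close> is at
  most the \<open>i\<close>-th diagonal entry of \<open>B * B\<close>, which is the outer degree of vertex \<open>i\<close>. So the
  energy is at most the sum over all vertices of the square roots of the outer degrees. Estimating
  every inner degree in the Randic index by the maximum degree bounds that sum.\<close>

section \<open>Existence of the square root, by maximizing a trace over the orthogonal
  matrices\<close>

lemma abs_le_1_if_sum_squares_eq_1:
  fixes g :: "nat \<Rightarrow> real"
  assumes "(\<Sum>k<n. g k * g k) = 1" and "j < n"
  shows "\<bar>g j\<bar> \<le> 1"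
proof -
  have "g j * g j \<le> (\<Sum>k<n. g k * g k)"
    by (rule member_le_sum) (use assms in auto)
  then show ?thesis
    using assms(1) by (metis abs_square_le_1 power2_eq_square)
qed

text \<open>The orthogonal matrices form a compact set and the trace is continuous on it. Matrices
  are encoded as functions on index pairs, so that both facts can be stated in the product
  topology.\<close>

lemma ex_orthogonal_maximizing_trace:
  assumes A: "A \<in> carrier_mat n n"
  shows "\<exists>Q \<in> carrier_mat n n. Q * Q\<^sup>T = 1\<^sub>m n \<and>
    (\<forall>R \<in> carrier_mat n n. R * R\<^sup>T = 1\<^sub>m n \<longrightarrow> mat_trace (A * R) \<le> mat_trace (A * Q))"
proof -
  \<comment> \<open>The cube runs over all index pairs, also those outside the \<open>n\<close> by
    \<open>n\<close> block, and is compact by Tychonoff's theorem.\<close>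
  define B :: "(nat \<times> nat \<Rightarrow> real) set"
    where "B = PiE UNIV (\<lambda>_. {-1..1})"
  define S where "S = {f \<in> B. \<forall>i\<in>{..<n}. \<forall>j\<in>{..<n}.
    (\<Sum>k<n. f (i, k) * f (j, k)) = (if i = j then 1 else 0)}"
  define t where "t f = (\<Sum>i<n. \<Sum>k<n. A $$ (i, k) * f (k, i))" for f :: "nat \<times> nat \<Rightarrow> real"
  have "compact B"
    using compactin_PiE[of "\<lambda>_. euclidean" UNIV "\<lambda>_. {-1..1::real}"]
    unfolding B_def compactin_euclidean_iff[symmetric] euclidean_product_topology[symmetric]
    by simp
  have coord: "continuous_on UNIV (\<lambda>f :: nat \<times> nat \<Rightarrow> real. f p)" for p
    by (rule continuous_on_product_coordinates)
  have "closed {f :: nat \<times> nat \<Rightarrow> real. \<forall>i\<in>{..<n}. \<forall>j\<in>{..<n}.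
    (\<Sum>k<n. f (i, k) * f (j, k)) = (if i = j then 1 else 0)}"
    unfolding Ball_def
    by (intro closed_Collect_all closed_Collect_imp open_Collect_const closed_Collect_eq continuous_on_sum continuous_on_mult coord
        continuous_on_const)
  then have "compact S"
    unfolding S_def Collect_conj_eq using \<open>compact B\<close> by (simp add: compact_Int_closed)
  have mat: "mat n n f * (mat n n f)\<^sup>T = 1\<^sub>m n \<longleftrightarrow> (\<forall>i\<in>{..<n}. \<forall>j\<in>{..<n}.
    (\<Sum>k<n. f (i, k) * f (j, k)) = (if i = j then 1 else (0::real)))" for f
    by (auto simp: mat_eq_iff scalar_prod_def lessThan_atLeast0)
  have tr: "mat_trace (A * mat n n f) = t f" for f
    using A by (simp add: mat_trace_def t_def scalar_prod_def lessThan_atLeast0)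
  have inS: "\<exists>f\<in>S. R = mat n n f" if R: "R \<in> carrier_mat n n" "R * R\<^sup>T = 1\<^sub>m n" for R
  proof -
    \<comment> \<open>The value 0 outside the block keeps \<open>f\<close> in the cube; inside the
      block the rows are unit vectors, which bounds the entries.\<close>
    define f where "f = (\<lambda>(i, j). if i < n \<and> j < n then R $$ (i, j) else 0)"
    have Rf: "R = mat n n f" using R(1) by (auto simp: f_def)
    with R(2) have o: "\<forall>i\<in>{..<n}. \<forall>j\<in>{..<n}.
      (\<Sum>k<n. f (i, k) * f (j, k)) = (if i = j then 1 else 0)" by (simp only: mat)
    have "\<bar>f (i, j)\<bar> \<le> 1" for i j
    proof (cases "i < n \<and> j < n")
      case True
      then show ?thesis using o abs_le_1_if_sum_squares_eq_1[of "\<lambda>k. f (i, k)" n j] by auto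
    qed (auto simp: f_def)
    then have "f \<in> B" by (auto simp: B_def abs_le_iff minus_le_iff)
    with o Rf show ?thesis by (auto simp: S_def)
  qed
  have "S \<noteq> {}" using inS[of "1\<^sub>m n"] by auto
  moreover have "continuous_on S t"
    unfolding t_def
    by (intro continuous_on_sum continuous_on_mult continuous_on_const
        continuous_on_subset[OF coord]) auto
  ultimately obtain f where f: "f \<in> S" "\<And>g. g \<in> S \<Longrightarrow> t g \<le> t f"
    using continuous_attains_sup[OF \<open>compact S\<close>] by blast
  show ?thesis
  proof (intro bexI[of _ "mat n n f"] conjI ballI impI)
    show "mat n n f * (mat n n f)\<^sup>T = 1\<^sub>m n" using f(1) unfolding mat S_def by blast
    fix R :: "real mat" assume "R \<in> carrier_mat n n" "R * R\<^sup>T = 1\<^sub>m n"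
    then show "mat_trace (A * R) \<le> mat_trace (A * mat n n f)"
      using inS f(2) tr by metis
  qed auto
qed

text \<open>\<open>R\<close> is the Householder reflection along \<open>x\<close>.\<close>

lemma quadratic_form_nonneg_if_trace_le:
  assumes P: "P \<in> carrier_mat n n"
    and max: "\<And>R. R \<in> carrier_mat n n \<Longrightarrow> R * R\<^sup>T = 1\<^sub>m n \<Longrightarrow> mat_trace (P * R) \<le> mat_trace P"
    and x: "x \<in> carrier_vec n"
  shows "0 \<le> scalar_prod x (P *\<^sub>v x)"
proof (cases "(\<Sum>k<n. x $ k * x $ k) = 0")
  case True
  then have "\<forall>k<n. x $ k = 0" by (subst (asm) sum_nonneg_eq_0_iff) auto
  then show ?thesis using P x by (simp add: scalar_prod_def)
next
  case False
  define s where "s = (\<Sum>k<n. x $ k * x $ k)"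
  have s: "s > 0" using False by (simp add: s_def sum_nonneg order_less_le)
  define d where "d i j = (if i = j then 1 else (0::real))" for i j :: nat
  define R where "R = mat n n (\<lambda>(i, j). d i j - 2 / s * (x $ i * x $ j))"
  have "(\<Sum>k<n. (d i k - 2 / s * (x $ i * x $ k)) * (d j k - 2 / s * (x $ j * x $ k))) = d i j"
    if "i < n" "j < n" for i j
  proof -
    have "(d i k - 2 / s * (x $ i * x $ k)) * (d j k - 2 / s * (x $ j * x $ k)) =
      d i k * d j k - 2 / s * x $ i * (d j k * x $ k) - 2 / s * x $ j * (d i k * x $ k)
      + 4 / s\<^sup>2 * x $ i * x $ j * (x $ k * x $ k)" for k
      using s by (simp add: field_simps power2_eq_square)
    then have "(\<Sum>k<n. (d i k - 2 / s * (x $ i * x $ k)) * (d j k - 2 / s * (x $ j * x $ k))) =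
      (\<Sum>k<n. d i k * d j k) - 2 / s * x $ i * (\<Sum>k<n. d j k * x $ k)
      - 2 / s * x $ j * (\<Sum>k<n. d i k * x $ k) + 4 / s\<^sup>2 * x $ i * x $ j * s"
      by (simp add: sum.distrib sum_subtractf sum_distrib_left s_def)
    \<comment> \<open>The two middle terms each contribute \<open>- 2 / s * x $ i * x $ j\<close>,
      and the last term is \<open>4 / s * x $ i * x $ j\<close>, so they cancel.\<close>
    also have "\<dots> = d i j"
      using that s
      by (simp add: d_def if_distrib[of "\<lambda>u. u * _"] power2_eq_square cong: if_cong)
    finally show ?thesis .
  qed
  then have "R * R\<^sup>T = 1\<^sub>m n"
    by (intro eq_matI) (auto simp: R_def scalar_prod_def lessThan_atLeast0 d_def)
  then have "mat_trace (P * R) \<le> mat_trace P" by (intro max) (auto simp: R_def)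
  \<comment> \<open>The reflection changes the trace by a negative multiple of the quadratic form,
    so maximality determines the sign of the form.\<close>
  moreover have "mat_trace (P * R) = mat_trace P - 2 / s * scalar_prod x (P *\<^sub>v x)"
  proof -
    have "(\<Sum>k<n. P $$ (i, k) * (d k i - 2 / s * (x $ k * x $ i))) =
      P $$ (i, i) - 2 / s * (x $ i * (\<Sum>k<n. P $$ (i, k) * x $ k))" if "i < n" for i
    proof -
      have "(\<Sum>k<n. P $$ (i, k) * (d k i - 2 / s * (x $ k * x $ i))) =
        (\<Sum>k<n. P $$ (i, k) * d k i - 2 / s * (x $ i * (P $$ (i, k) * x $ k)))"
        by (intro sum.cong) (auto simp: algebra_simps)
      also have "\<dots> = (\<Sum>k<n. P $$ (i, k) * d k i) - 2 / s * (x $ i * (\<Sum>k<n. P $$ (i, k) * x $ k))"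
        by (simp add: sum_subtractf sum_distrib_left)
      finally show ?thesis
        using that by (simp add: d_def if_distrib[of "\<lambda>u. _ * u"] cong: if_cong)
    qed
    then show ?thesis
      using P x
      by (simp add: mat_trace_def R_def scalar_prod_def lessThan_atLeast0[symmetric]
          sum_subtractf sum_distrib_left)
  qed
  ultimately have "2 / s * scalar_prod x (P *\<^sub>v x) \<ge> 0" by simp
  then show ?thesis using s by (simp add: zero_le_mult_iff zero_le_divide_iff)
qed

text \<open>Isolates the two coordinates that a plane rotation moves.\<close>

lemma sum_split_two:
  fixes g :: "nat \<Rightarrow> real"
  assumes "i < n" "j < n" "i \<noteq> j"
  shows "(\<Sum>k<n. g k) = g i + g j + (\<Sum>k\<in>{..<n} - {i, j}. g k)"
proof -
  have "{..<n} - {i} - {j} = {..<n} - {i, j}" by auto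
  then show ?thesis
    using assms sum.remove[of "{..<n}" i g] sum.remove[of "{..<n} - {i}" j g] by simp
qed

text \<open>\<open>R\<close> is a rotation in the \<open>(i, j)\<close> plane; its angle maximizes \<open>c * e + s * d\<close> over the
  unit circle.\<close>

lemma symmetric_if_trace_le:
  assumes P: "P \<in> carrier_mat n n"
    and max: "\<And>R. R \<in> carrier_mat n n \<Longrightarrow> R * R\<^sup>T = 1\<^sub>m n \<Longrightarrow> mat_trace (P * R) \<le> mat_trace P"
    and ij: "i < n" "j < n" "i \<noteq> j"
  shows "P $$ (i, j) = P $$ (j, i)"
proof (rule ccontr)
  assume neq: "P $$ (i, j) \<noteq> P $$ (j, i)"
  define e where "e = P $$ (i, i) + P $$ (j, j)"
  define d where "d = P $$ (j, i) - P $$ (i, j)"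
  define r where "r = sqrt (e\<^sup>2 + d\<^sup>2)"
  have "d \<noteq> 0" using neq by (simp add: d_def)
  then have r: "r > 0" "r\<^sup>2 = e\<^sup>2 + d\<^sup>2"
    by (simp_all add: r_def add_nonneg_pos)
  define c where "c = e / r"
  define s where "s = d / r"
  have cs: "c * c + s * s = 1" "s * s + c * c = 1"
    using r \<open>d \<noteq> 0\<close> by (simp_all add: c_def s_def power2_eq_square add_divide_distrib[symmetric])
  define g where "g a b = (if a = i then (if b = i then c else if b = j then s else 0)
    else if a = j then (if b = i then - s else if b = j then c else 0)
    else if a = b then 1 else 0)" for a b
  define R where "R = mat n n (\<lambda>(a, b). g a b)"
  have "(\<Sum>k<n. g a k * g b k) = (if a = b then 1 else 0)" if "a < n" "b < n" for a b
  proof -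
    \<comment> \<open>Rows \<open>i\<close> and \<open>j\<close> of the rotation are supported on
      \<open>{i, j}\<close>, so a product involving one of them reduces to two terms; all other rows
      are unit vectors.\<close>
    consider "a \<in> {i, j}" | "b \<in> {i, j}" | "a \<notin> {i, j}" "b \<notin> {i, j}" by blast
    then show ?thesis
    proof cases
      case 3
      then have "(\<Sum>k<n. g a k * g b k) = (\<Sum>k<n. if k = a then (if a = b then 1 else 0) else 0)"
        by (intro sum.cong) (auto simp: g_def)
      with that show ?thesis by simp
    next
      case 1
      then have z: "(\<Sum>k\<in>{..<n} - {i, j}. g a k * g b k) = 0"
        by (intro sum.neutral) (auto simp: g_def)
      show ?thesis
        unfolding sum_split_two[OF ij] z using 1 ij cs by (auto simp: g_def)
    next
      case 2
      then have z: "(\<Sum>k\<in>{..<n} - {i, j}. g a k * g b k) = 0"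
        by (intro sum.neutral) (auto simp: g_def)
      show ?thesis
        unfolding sum_split_two[OF ij] z using 2 ij cs by (auto simp: g_def)
    qed
  qed
  then have "R * R\<^sup>T = 1\<^sub>m n"
    by (intro eq_matI) (auto simp: R_def scalar_prod_def lessThan_atLeast0)
  then have le: "mat_trace (P * R) \<le> mat_trace P" by (intro max) (auto simp: R_def)
  have tr: "mat_trace (P * R) = (\<Sum>a<n. \<Sum>k<n. P $$ (a, k) * g k a)"
    using P by (simp add: mat_trace_def R_def scalar_prod_def lessThan_atLeast0)
  have i: "(\<Sum>k<n. P $$ (i, k) * g k i) = P $$ (i, i) * c - P $$ (i, j) * s"
  proof -
    have z: "(\<Sum>k\<in>{..<n} - {i, j}. P $$ (i, k) * g k i) = 0"
      by (intro sum.neutral) (auto simp: g_def)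
    show ?thesis unfolding sum_split_two[OF ij] z using ij by (auto simp: g_def)
  qed
  have j: "(\<Sum>k<n. P $$ (j, k) * g k j) = P $$ (j, i) * s + P $$ (j, j) * c"
  proof -
    have z: "(\<Sum>k\<in>{..<n} - {i, j}. P $$ (j, k) * g k j) = 0"
      by (intro sum.neutral) (auto simp: g_def)
    show ?thesis unfolding sum_split_two[OF ij] z using ij by (auto simp: g_def)
  qed
  have a: "(\<Sum>k<n. P $$ (a, k) * g k a) = P $$ (a, a)" if "a \<in> {..<n} - {i, j}" for a
  proof -
    have "(\<Sum>k<n. P $$ (a, k) * g k a) = (\<Sum>k<n. if k = a then P $$ (a, a) else 0)"
      using that by (intro sum.cong) (auto simp: g_def)
    with that show ?thesis by simp
  qed
  have "mat_trace (P * R) = (P $$ (i, i) * c - P $$ (i, j) * s) + (P $$ (j, i) * s + P $$ (j, j) * c)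
      + (\<Sum>a\<in>{..<n} - {i, j}. P $$ (a, a))"
    unfolding tr sum_split_two[OF ij, of "\<lambda>a. \<Sum>k<n. P $$ (a, k) * g k a"] i j
    using a by simp
  moreover have "mat_trace P = P $$ (i, i) + P $$ (j, j) + (\<Sum>a\<in>{..<n} - {i, j}. P $$ (a, a))"
    using P sum_split_two[OF ij, of "\<lambda>a. P $$ (a, a)"] by (simp add: mat_trace_def)
  ultimately have "mat_trace (P * R) - mat_trace P = c * e + s * d - e"
    by (simp add: e_def d_def algebra_simps)
  \<comment> \<open>The rotation replaces the contribution \<open>e\<close> to the trace by
    \<open>r\<close>. Since \<open>d\<close> is nonzero, \<open>r\<close> exceeds \<open>e\<close>,
    against maximality.\<close>
  moreover have "c * e + s * d = r"
    using r by (simp add: c_def s_def field_simps power2_eq_square)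
  ultimately have "r \<le> e" using le by simp
  then have "r\<^sup>2 \<le> e\<^sup>2" using r(1) by (intro power_mono) auto
  then show False using r \<open>d \<noteq> 0\<close> by simp
qed

text \<open>Polar decomposition: if \<open>Q\<close> is orthogonal and maximizes the trace of \<open>A * Q\<close>, then
  \<open>A * Q\<close> is the square root.\<close>

lemma ex_psd_sqrt_mult_transpose:
  assumes A: "A \<in> carrier_mat n n"
  shows "\<exists>P. psd_mat P \<and> P * P = A * A\<^sup>T"
proof -
  obtain Q where Q: "Q \<in> carrier_mat n n" "Q * Q\<^sup>T = 1\<^sub>m n"
    and max: "\<And>R. R \<in> carrier_mat n n \<Longrightarrow> R * R\<^sup>T = 1\<^sub>m n \<Longrightarrow> mat_trace (A * R) \<le> mat_trace (A * Q)"
    using ex_orthogonal_maximizing_trace[OF A] by blast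
  define P where "P = A * Q"
  have P: "P \<in> carrier_mat n n" using A Q by (simp add: P_def)
  \<comment> \<open>Since \<open>Q * R\<close> is again orthogonal, the maximality of
    \<open>Q\<close> for \<open>A\<close> becomes maximality of the identity for
    \<open>P\<close>.\<close>
  have maxP: "mat_trace (P * R) \<le> mat_trace P"
    if R: "R \<in> carrier_mat n n" "R * R\<^sup>T = 1\<^sub>m n" for R
  proof -
    have "(Q * R) * (Q * R)\<^sup>T = Q * (R * R\<^sup>T) * Q\<^sup>T"
      using Q(1) R(1) by (simp add: transpose_mult[of _ n n _ n] assoc_mult_mat[of _ n n _ n _ n])
    also have "\<dots> = 1\<^sub>m n" using Q R by simp
    finally have "mat_trace (A * (Q * R)) \<le> mat_trace (A * Q)"
      using Q R by (intro max) auto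
    then show ?thesis using A Q R by (simp add: P_def assoc_mult_mat[of _ n n _ n _ n])
  qed
  have "P $$ (j, i) = P $$ (i, j)" if "i < n" "j < n" for i j
    using symmetric_if_trace_le[OF P maxP] that by (cases "i = j") auto
  then have sym: "P\<^sup>T = P" using P by (intro eq_matI) auto
  have "psd_mat P"
    using P sym quadratic_form_nonneg_if_trace_le[OF P maxP] by (auto simp: psd_mat_def)
  moreover have "P * P = A * A\<^sup>T"
  proof -
    have "P * P = P * P\<^sup>T" by (simp add: sym)
    also have "\<dots> = A * (Q * Q\<^sup>T) * A\<^sup>T"
      using A Q(1)
      by (simp add: P_def transpose_mult[of _ n n _ n] assoc_mult_mat[of _ n n _ n _ n])
    also have "\<dots> = A * A\<^sup>T" using A Q by simp
    finally show ?thesis .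
  qed
  ultimately show ?thesis by blast
qed

section \<open>Uniqueness of the positive semidefinite square root\<close>

lemma psd_mat_carrier:
  "psd_mat B \<Longrightarrow> dim_row B = n \<Longrightarrow> B \<in> carrier_mat n n"
  by (auto simp: psd_mat_def)

text \<open>Along the line through \<open>x\<close> with direction \<open>y = B *\<^sub>v x\<close>
  the quadratic form is nonnegative and vanishes at \<open>x\<close>. Its derivative there, twice
  the squared length of \<open>y\<close>, must therefore be 0.\<close>

lemma psd_mat_mult_vec_eq_0:
  assumes "psd_mat B" and B: "B \<in> carrier_mat n n" and x: "x \<in> carrier_vec n"
    and 0: "scalar_prod x (B *\<^sub>v x) = 0"
  shows "B *\<^sub>v x = 0\<^sub>v n"
proof -
  define y where "y = B *\<^sub>v x"
  have y: "y \<in> carrier_vec n" using B x by (simp add: y_def)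
  define a where "a = scalar_prod y y"
  define c where "c = scalar_prod y (B *\<^sub>v y)"
  have psd: "0 \<le> scalar_prod z (B *\<^sub>v z)" if "z \<in> carrier_vec n" for z
    using assms that by (auto simp: psd_mat_def)
  have c: "c \<ge> 0" unfolding c_def by (rule psd[OF y])
  have xy: "scalar_prod x (B *\<^sub>v y) = a"
    using transpose_vec_mult_scalar[OF B y x] assms(1)
    by (simp add: psd_mat_def a_def y_def)
  \<comment> \<open>The minimum of \<open>2 * t * a + t * t * c\<close> lies at
    \<open>- a / c\<close>; the denominator \<open>c + 1\<close> avoids the case
    \<open>c = 0\<close> and still makes the value negative unless \<open>a = 0\<close>.\<close>
  define t where "t = - (a / (c + 1))"
  have "0 \<le> scalar_prod (x + t \<cdot>\<^sub>v y) (B *\<^sub>v (x + t \<cdot>\<^sub>v y))"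
    using x y by (intro psd) simp
  also have "B *\<^sub>v (x + t \<cdot>\<^sub>v y) = y + t \<cdot>\<^sub>v (B *\<^sub>v y)"
    using B x y by (simp add: mult_add_distrib_mat_vec[of _ n n] mult_mat_vec[of _ n n] y_def)
  also have "scalar_prod (x + t \<cdot>\<^sub>v y) (y + t \<cdot>\<^sub>v (B *\<^sub>v y)) = 2 * t * a + t * t * c"
  proof -
    have By: "B *\<^sub>v y \<in> carrier_vec n" using B y by simp
    have "scalar_prod x y = 0" using 0 by (simp add: y_def)
    then show ?thesis
      using x y By xy
      by (simp add: add_scalar_prod_distrib[of _ n] scalar_prod_add_distrib[of _ n]
          a_def[symmetric] c_def[symmetric] algebra_simps)
  qed
  also have "\<dots> = - (t\<^sup>2 * (c + 2))"
  proof -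
    have "a = - t * (c + 1)" using c by (simp add: t_def)
    then have "2 * t * a = 2 * t * (- t * (c + 1))" by (rule arg_cong)
    then show ?thesis by (simp add: algebra_simps power2_eq_square)
  qed
  finally have "t = 0" using c by (simp add: mult_le_0_iff)
  then have "a = 0" using c by (simp add: t_def)
  then have "(\<Sum>k<n. y $ k * y $ k) = 0"
    using y by (simp add: a_def scalar_prod_def lessThan_atLeast0)
  then have "\<forall>k<n. y $ k = 0" by (subst (asm) sum_nonneg_eq_0_iff) auto
  then show ?thesis using y unfolding y_def[symmetric] by (intro eq_vecI) auto
qed

lemma mat_trace_mult_comm:
  assumes "A \<in> carrier_mat n n" "B \<in> carrier_mat n n"
  shows "mat_trace (A * B) = mat_trace (B * A)"
proof -
  have "mat_trace (A * B) = (\<Sum>i<n. \<Sum>k<n. A $$ (i, k) * B $$ (k, i))"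
    using assms by (simp add: mat_trace_def scalar_prod_def lessThan_atLeast0)
  also have "\<dots> = (\<Sum>k<n. \<Sum>i<n. B $$ (k, i) * A $$ (i, k))"
    by (subst sum.swap) (simp add: mult.commute)
  also have "\<dots> = mat_trace (B * A)"
    using assms by (simp add: mat_trace_def scalar_prod_def lessThan_atLeast0)
  finally show ?thesis .
qed

text \<open>For positive semidefinite \<open>B\<close> all summands are nonnegative. Hence the trace
  is nonnegative, and if it vanishes then so does every summand.\<close>

lemma mat_trace_congruence:
  assumes "D \<in> carrier_mat n n" "B \<in> carrier_mat n n" "D\<^sup>T = D"
  shows "mat_trace (D * (B * D)) = (\<Sum>i<n. scalar_prod (col D i) (B *\<^sub>v col D i))"
proof -
  have "(D * (B * D)) $$ (i, i) = scalar_prod (col D i) (B *\<^sub>v col D i)" if "i < n" for i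
  proof -
    have "row D i = col D i" using assms that by (metis carrier_matD(2) row_transpose)
    then show ?thesis
      using assms that by (simp add: col_mult2[of _ n n _ n] del: col_mult)
  qed
  then show ?thesis using assms by (simp add: mat_trace_def)
qed

text \<open>The quadratic form of \<open>B\<close> vanishes on each column of \<open>D\<close>, so
  \<open>B\<close> annihilates each column.\<close>

lemma mult_eq_0_if_trace_congruence_eq_0:
  assumes D: "D \<in> carrier_mat n n" "D\<^sup>T = D" and B: "B \<in> carrier_mat n n" "psd_mat B"
    and tr: "mat_trace (D * (B * D)) = 0"
  shows "B * D = 0\<^sub>m n n"
proof -
  have "\<forall>i<n. scalar_prod (col D i) (B *\<^sub>v col D i) = 0"
    using tr D B unfolding mat_trace_congruence[OF D(1) B(1) D(2)]
    by (subst (asm) sum_nonneg_eq_0_iff) (auto simp: psd_mat_def)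
  then have "B *\<^sub>v col D i = 0\<^sub>v n" if "i < n" for i
    using that D B by (intro psd_mat_mult_vec_eq_0) auto
  then have "col (B * D) i = col (0\<^sub>m n n) i" if "i < n" for i
    using that D B by (simp add: col_mult2[of _ n n _ n])
  then show ?thesis using B D by (intro mat_col_eqI) auto
qed

lemma mat_trace_congruence_nonneg:
  assumes D: "D \<in> carrier_mat n n" "D\<^sup>T = D" and B: "B \<in> carrier_mat n n" "psd_mat B"
  shows "0 \<le> mat_trace (D * (B * D))"
  unfolding mat_trace_congruence[OF D(1) B(1) D(2)]
  using D B by (auto simp: psd_mat_def intro!: sum_nonneg)

text \<open>With \<open>D = B - C\<close> one has \<open>B * D + D * C = 0\<close>; multiplying by \<open>D\<close> and taking traces gives
  a vanishing sum of the nonnegative traces of \<open>D * B * D\<close> and \<open>D * C * D\<close>.\<close>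

lemma psd_sqrt_unique:
  assumes "psd_mat B" "psd_mat C" "B * B = C * C"
  shows "B = C"
proof -
  define n where "n = dim_row B"
  have B: "B \<in> carrier_mat n n" by (rule psd_mat_carrier[OF assms(1) n_def[symmetric]])
  have "dim_row (B * B) = dim_row (C * C)" by (simp only: assms(3))
  then have "dim_row C = n" by (simp add: n_def)
  then have C: "C \<in> carrier_mat n n" by (rule psd_mat_carrier[OF assms(2)])
  have symB: "B\<^sup>T = B" and symC: "C\<^sup>T = C" using assms(1,2) by (simp_all only: psd_mat_def)
  define D where "D = B - C"
  have D: "D \<in> carrier_mat n n" using B C by (auto simp: D_def)
  have symD: "D\<^sup>T = D" using B C symB symC by (simp add: D_def transpose_minus)
  have "B * D + D * C = 0\<^sub>m n n"
  proof -
    have "B * D = B * B - B * C" unfolding D_def by (rule mult_minus_distrib_mat[OF B B C])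
    moreover have "D * C = B * C - C * C" unfolding D_def by (rule minus_mult_distrib_mat[OF B C C])
    moreover have "X - Y + (Y - X) = 0\<^sub>m n n"
      if "X \<in> carrier_mat n n" "Y \<in> carrier_mat n n" for X Y :: "real mat"
      using that by (intro eq_matI) auto
    ultimately show ?thesis using B C assms(3) by simp
  qed
  then have "D * (B * D) + D * (D * C) = 0\<^sub>m n n"
    using B C D mult_add_distrib_mat[of D n n "B * D" n "D * C"] by simp
  then have "mat_trace (D * (B * D) + D * (D * C)) = 0" by (simp add: mat_trace_def)
  then have "mat_trace (D * (B * D)) + mat_trace (D * (D * C)) = 0"
    using B C D by (simp add: mat_trace_def sum.distrib)
  \<comment> \<open>Cyclicity of the trace turns the second term into a congruence of
    \<open>C\<close>.\<close>
  moreover have "mat_trace (D * (D * C)) = mat_trace (D * (C * D))"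
    using mat_trace_mult_comm[of D n "D * C"] C D by (simp add: assoc_mult_mat[of _ n n _ n _ n])
  ultimately have "mat_trace (D * (B * D)) = 0" "mat_trace (D * (C * D)) = 0"
    using mat_trace_congruence_nonneg[OF D symD B assms(1)]
      mat_trace_congruence_nonneg[OF D symD C assms(2)] by linarith+
  then have "B * D = 0\<^sub>m n n" "C * D = 0\<^sub>m n n"
    using mult_eq_0_if_trace_congruence_eq_0 D symD B C assms by blast+
  then have "D * D = 0\<^sub>m n n"
    using minus_mult_distrib_mat[OF B C D] by (simp add: D_def[symmetric])
  \<comment> \<open>With the identity as the positive semidefinite matrix, the same vanishing
    criterion passes from \<open>D * D = 0\<close> to \<open>D = 0\<close>.\<close>
  have "mat_trace (D * (1\<^sub>m n * D)) = 0"
    using \<open>D * D = 0\<^sub>m n n\<close> D by (simp add: mat_trace_def)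
  moreover have "psd_mat (1\<^sub>m n)"
    by (auto simp: psd_mat_def scalar_prod_def intro!: sum_nonneg)
  ultimately have "1\<^sub>m n * D = 0\<^sub>m n n"
    using mult_eq_0_if_trace_congruence_eq_0 D symD one_carrier_mat by blast
  then have "D = 0\<^sub>m n n" using D by simp
  show ?thesis
  proof (rule eq_matI)
    fix i j assume "i < dim_row C" "j < dim_col C"
    moreover from this have "D $$ (i, j) = 0" using \<open>D = 0\<^sub>m n n\<close> C by simp
    ultimately show "B $$ (i, j) = C $$ (i, j)" using B C by (simp add: D_def)
  qed (use B C in auto)
qed

section \<open>The trace of the square root\<close>

text \<open>Existence and uniqueness together ensure that the definite description in
  \<open>mat_sqrt\<close> denotes the square root.\<close>

lemma mat_sqrt_mult_transpose:
  assumes "A \<in> carrier_mat n n"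
  shows "psd_mat (mat_sqrt (A * A\<^sup>T))"
    and "mat_sqrt (A * A\<^sup>T) * mat_sqrt (A * A\<^sup>T) = A * A\<^sup>T"
proof -
  have "\<exists>!B. psd_mat B \<and> B * B = A * A\<^sup>T"
    using ex_psd_sqrt_mult_transpose[OF assms] psd_sqrt_unique by metis
  from theI'[OF this] show "psd_mat (mat_sqrt (A * A\<^sup>T))"
    and "mat_sqrt (A * A\<^sup>T) * mat_sqrt (A * A\<^sup>T) = A * A\<^sup>T"
    by (simp_all add: mat_sqrt_def)
qed

text \<open>By symmetry the diagonal entry of \<open>B * B\<close> is the sum of the squares of row
  \<open>i\<close>, one of which is the square of the diagonal entry of \<open>B\<close>.\<close>

lemma psd_mat_diag_le_sqrt:
  assumes "psd_mat B" "B \<in> carrier_mat n n" "i < n"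
  shows "B $$ (i, i) \<le> sqrt ((B * B) $$ (i, i))"
proof -
  have sym: "B $$ (k, i) = B $$ (i, k)" if "k < n" for k
  proof -
    have "B\<^sup>T $$ (i, k) = B $$ (k, i)" using assms that by simp
    then show ?thesis using assms(1) by (simp add: psd_mat_def)
  qed
  have "(B $$ (i, i))\<^sup>2 \<le> (\<Sum>k<n. (B $$ (i, k))\<^sup>2)"
    by (rule member_le_sum) (use assms in auto)
  also have "\<dots> = (B * B) $$ (i, i)"
    using assms by (simp add: scalar_prod_def lessThan_atLeast0 power2_eq_square sym)
  finally show ?thesis by (rule real_le_rsqrt)
qed

lemma mat_trace_sqrt_mult_transpose_le:
  assumes A: "A \<in> carrier_mat n n"
  shows "mat_trace (mat_sqrt (A * A\<^sup>T)) \<le> (\<Sum>i<n. sqrt ((A * A\<^sup>T) $$ (i, i)))"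
proof -
  define B where "B = mat_sqrt (A * A\<^sup>T)"
  have B: "psd_mat B" "B * B = A * A\<^sup>T"
    using mat_sqrt_mult_transpose[OF A] by (simp_all add: B_def)
  \<comment> \<open>The size of \<open>B\<close> is read off from its square, as
    \<open>mat_sqrt\<close> says nothing about it directly.\<close>
  have "dim_row B = n" using B(2) A by (metis carrier_matD(1) index_mult_mat(2))
  then have Bn: "B \<in> carrier_mat n n" by (rule psd_mat_carrier[OF B(1)])
  have "mat_trace B \<le> (\<Sum>i<n. sqrt ((B * B) $$ (i, i)))"
    unfolding mat_trace_def using psd_mat_diag_le_sqrt[OF B(1) Bn] \<open>dim_row B = n\<close>
    by (auto intro!: sum_mono)
  then show ?thesis unfolding B(2) by (simp add: B_def)
qed

section \<open>Degrees and the Randic index\<close>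

lemma (in pair_digraph) out_degree_eq_card:
  "out_degree (with_proj G) v = card {w \<in> pverts G. (v, w) \<in> parcs G}"
proof -
  have "out_arcs (with_proj G) v = Pair v ` {w \<in> pverts G. (v, w) \<in> parcs G}"
    using in_arcsD2 by (auto simp: out_arcs_def)
  then show ?thesis by (simp add: out_degree_def card_image inj_on_def)
qed

text \<open>A row of the adjacency matrix is a 0/1 vector, so its product with itself counts
  out-neighbours. Reindexing along \<open>vs\<close> removes the enumeration from the bound.\<close>

lemma (in pair_digraph) energy_le_sum_sqrt_out_degree:
  assumes "distinct vs" "set vs = pverts G"
  shows "energy G vs \<le> (\<Sum>v\<in>pverts G. sqrt (real (out_degree (with_proj G) v)))"
proof -
  define n where "n = length vs"
  define A where "A = adjacency_mat G vs"
  have A: "A \<in> carrier_mat n n" by (simp add: A_def adjacency_mat_def n_def)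
  have bij: "bij_betw ((!) vs) {..<n} (pverts G)"
    using bij_betw_nth[OF assms(1) _ assms(2)[symmetric]] by (simp add: n_def)
  have "(A * A\<^sup>T) $$ (i, i) = real (out_degree (with_proj G) (vs ! i))" if "i < n" for i
  proof -
    have "(A * A\<^sup>T) $$ (i, i) = (\<Sum>k<n. if (vs ! i, vs ! k) \<in> parcs G then 1 else 0)"
      using that
      by (auto simp: A_def adjacency_mat_def n_def scalar_prod_def lessThan_atLeast0 intro!: sum.cong)
    also have "\<dots> = (\<Sum>w\<in>pverts G. if (vs ! i, w) \<in> parcs G then 1 else 0)"
      by (rule sum.reindex_bij_betw[OF bij])
    also have "\<dots> = real (out_degree (with_proj G) (vs ! i))"
      by (simp add: out_degree_eq_card sum.If_cases Collect_conj_eq Int_commute)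
    finally show ?thesis .
  qed
  then have "energy G vs \<le> (\<Sum>i<n. sqrt (real (out_degree (with_proj G) (vs ! i))))"
    using mat_trace_sqrt_mult_transpose_le[OF A] by (simp add: energy_def A_def)
  also have "\<dots> = (\<Sum>v\<in>pverts G. sqrt (real (out_degree (with_proj G) v)))"
    by (rule sum.reindex_bij_betw[OF bij])
  finally show ?thesis .
qed

text \<open>The root of an outer degree is spread evenly over the outgoing arcs, and the sums are
  compared arc by arc. Without vertices both sides are 0, whatever the value of
  \<open>max_degree G\<close>.\<close>

lemma (in pair_digraph) sum_sqrt_out_degree_le_randic_index:
  "(\<Sum>v\<in>pverts G. sqrt (real (out_degree (with_proj G) v)))
    \<le> 2 * sqrt (real (max_degree G)) * randic_index G"
proof -
  define p where "p v = real (out_degree (with_proj G) v)" for v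
  define q where "q v = real (in_degree (with_proj G) v)" for v
  define m where "m = real (max_degree G)"
  have arc: "1 / sqrt (p v) \<le> sqrt m * (1 / sqrt (p v * q w))" if vw: "(v, w) \<in> parcs G" for v w
  proof -
    have "v \<in> pverts G" "w \<in> pverts G" using vw in_arcsD1 in_arcsD2 by auto
    then have "q w \<le> m"
      unfolding q_def m_def max_degree_def of_nat_le_iff by (intro Max_ge) auto
    \<comment> \<open>The arc itself enters \<open>w\<close>, so the inner degree is positive and
      may be divided by.\<close>
    moreover have "(v, w) \<in> in_arcs (with_proj G) w" using vw by simp
    then have "in_arcs (with_proj G) w \<noteq> {}" by blast
    then have "q w > 0"
      unfolding q_def in_degree_def of_nat_0_less_iff
      by (subst card_gt_0_iff) (simp add: in_arcs_def)
    ultimately have "1 \<le> sqrt m / sqrt (q w)" by simp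
    then have "1 / sqrt (p v) * 1 \<le> 1 / sqrt (p v) * (sqrt m / sqrt (q w))"
      by (intro mult_left_mono) (auto simp: p_def)
    then show ?thesis by (simp add: real_sqrt_mult)
  qed
  \<comment> \<open>The sum has \<open>p v\<close> equal terms; if \<open>v\<close> has no outgoing
    arc, both sides are 0.\<close>
  have "sqrt (p v) = (\<Sum>w | w \<in> pverts G \<and> (v, w) \<in> parcs G. 1 / sqrt (p v))" for v
    by (simp add: p_def out_degree_eq_card real_div_sqrt)
  then have "(\<Sum>v\<in>pverts G. sqrt (p v)) =
      (\<Sum>v\<in>pverts G. \<Sum>w | w \<in> pverts G \<and> (v, w) \<in> parcs G. 1 / sqrt (p v))" by simp
  also have "\<dots> = (\<Sum>(v, w)\<in>(SIGMA v:pverts G. {w \<in> pverts G. (v, w) \<in> parcs G}). 1 / sqrt (p v))"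
    by (rule sum.Sigma) auto
  also have "(SIGMA v:pverts G. {w \<in> pverts G. (v, w) \<in> parcs G}) = parcs G"
    using in_arcsD1 in_arcsD2 by auto
  also have "(\<Sum>(v, w)\<in>parcs G. 1 / sqrt (p v)) \<le> (\<Sum>(v, w)\<in>parcs G. sqrt m * (1 / sqrt (p v * q w)))"
    using arc by (intro sum_mono) auto
  \<comment> \<open>The factor 2 cancels the \<open>1 / 2\<close> in the definition of the
    index.\<close>
  also have "\<dots> = 2 * sqrt m * randic_index G"
    by (simp add: randic_index_def p_def q_def sum_distrib_left case_prod_unfold)
  finally show ?thesis by (simp add: p_def m_def)
qed

theorem theorem9:
  fixes G :: "'a pair_pre_digraph" and vs :: "'a list"
  assumes "pair_digraph G"
    and "distinct vs" and "set vs = pverts G"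
  shows "energy G vs \<le> 2 * sqrt (real (max_degree G)) * randic_index G"
proof -
  interpret pair_digraph G by fact
  show ?thesis
    using energy_le_sum_sqrt_out_degree[OF assms(2,3)] sum_sqrt_out_degree_le_randic_index
    by (rule order_trans)
qed

end
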